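(* For $\alpha,\beta\in\mathbb{R}^{+}$, the Sumudu transform of the hypergeometric-Mittag-Leffler function is $$\mathcal{S}\big\{{}_{{}_2F_1}E_{(\alpha,\beta)}(a_1,a_2;b_1;-t):u\big\}={}_{{}_3F_1}E_{(\alpha,\beta)}(a_1,a_2,1;\,b_1;\,-u).$$
   Context: $(a)_r=\Gamma(a+r)/\Gamma(a)$ is the Pochhammer symbol. The generalized hypergeometric-Mittag-Leffler functions are given by $${}_{{}_pF_q}E_{(\alpha,\beta)}(a_1,\dots,a_p;b_1,\dots,b_q;u)=\sum_{r=0}^{\infty}\frac{(a_1)_r\cdots(a_p)_r}{(b_1)_r\cdots(b_q)_r}\,\frac{u^r}{\Gamma(\alpha r+\beta)} ;$$ the case $p=2$, $q=1$ is the hypergeometric-Mittag-Leffler function. The Sumudu transform of a function $f(t)$ is $\mathcal{S}\{f(t):u\}=\int_0^\infty e^{-t}f(ut)\,dt$.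
   Formalization: The formal theorem assumes that the series on the right-hand side converges at −u (it diverges for nonterminating series with α<2, u≠0, e.g. α=β=a₁=a₂=b₁=1) and that b₁ is not a nonpositive integer; convergence of the left series and of the integral is proved. *)

theory Defs
  imports "HOL-Analysis.Analysis" "HOL-Real_Asymp.Real_Asymp"
begin

text \<open>
  The numerator and denominator parameters are the lists \<open>as\<close> and \<open>bs\<close>. The library constant
  \<^const>\<open>pochhammer\<close> equals \<open>\<Gamma>(a + r) / \<Gamma>(a)\<close> unless \<open>a\<close> is a nonpositive integer
  (lemma \<open>pochhammer_Gamma\<close>); there it takes the usual product value.
\<close>

definition hyp_ML_term ::
    "real \<Rightarrow> real \<Rightarrow> complex list \<Rightarrow> complex list \<Rightarrow> complex \<Rightarrow> nat \<Rightarrow> complex" where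
  "hyp_ML_term \<alpha> \<beta> as bs u r =
     (\<Prod>a\<leftarrow>as. pochhammer a r) / (\<Prod>b\<leftarrow>bs. pochhammer b r)
       * (u ^ r / complex_of_real (Gamma (\<alpha> * real r + \<beta>)))"

definition hyp_ML ::
    "real \<Rightarrow> real \<Rightarrow> complex list \<Rightarrow> complex list \<Rightarrow> complex \<Rightarrow> complex" where
  "hyp_ML \<alpha> \<beta> as bs u = (\<Sum>r. hyp_ML_term \<alpha> \<beta> as bs u r)"

text \<open>
  The integral over \<open>[0, \<infinity>)\<close> is the Henstock--Kurzweil integral, which covers the improper
  Riemann integral.
\<close>

definition sumudu_integrand :: "(complex \<Rightarrow> complex) \<Rightarrow> complex \<Rightarrow> real \<Rightarrow> complex" where
  "sumudu_integrand f u t = complex_of_real (exp (- t)) * f (u * complex_of_real t)"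

definition sumudu :: "(complex \<Rightarrow> complex) \<Rightarrow> complex \<Rightarrow> complex" where
  "sumudu f u = integral {0..} (sumudu_integrand f u)"

lemma Gamma_shift_bound:
  fixes x d :: real
  assumes x: "x > 1" and d: "d > 0"
  shows "Gamma x / Gamma (x + d) \<le> (x - 1) powr (- d)"
proof -
  define s where "s = 1 / (1 + d)"
  have s: "0 \<le> s" "s \<le> 1" "s * (1 + d) = 1"
    using d by (auto simp: s_def field_simps)
  have eq: "(1 - s) *\<^sub>R (x - 1) + s *\<^sub>R (x + d) = x"
    using s(3) by (simp add: algebra_simps)
  have "(ln \<circ> Gamma) ((1 - s) *\<^sub>R (x - 1) + s *\<^sub>R (x + d))
          \<le> (1 - s) * (ln \<circ> Gamma) (x - 1) + s * (ln \<circ> Gamma) (x + d)"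
    using s x d by (intro convex_onD[OF log_convex_Gamma_real]) auto
  hence le: "ln (Gamma x) \<le> (1 - s) * ln (Gamma (x - 1)) + s * ln (Gamma (x + d))"
    unfolding eq by simp
  have pos: "Gamma x > 0" "Gamma (x - 1) > 0" "Gamma (x + d) > 0"
    using x d by (auto intro!: Gamma_real_pos)
  have "x - 1 \<notin> \<int>\<^sub>\<le>\<^sub>0" using x by (auto elim!: nonpos_Ints_cases)
  hence "Gamma x = (x - 1) * Gamma (x - 1)"
    using Gamma_plus1[of "x - 1"] by simp
  hence ln_eq: "ln (Gamma x) = ln (x - 1) + ln (Gamma (x - 1))"
    using pos(2) x by (metis diff_gt_0_iff_gt ln_mult_pos)
  have "(1 + d) * ln (Gamma x)
          \<le> (1 + d) * ((1 - s) * ln (Gamma (x - 1)) + s * ln (Gamma (x + d)))"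
    using le d by (intro mult_left_mono) auto
  also have "\<dots> = ((1 + d) - s * (1 + d)) * ln (Gamma (x - 1))
                     + (s * (1 + d)) * ln (Gamma (x + d))"
    by (simp add: algebra_simps)
  also have "\<dots> = d * ln (Gamma (x - 1)) + ln (Gamma (x + d))"
    using s(3) by simp
  finally have "ln (Gamma x) - ln (Gamma (x + d)) \<le> - d * ln (x - 1)"
    unfolding ln_eq by (simp add: algebra_simps)
  hence "ln (Gamma x / Gamma (x + d)) \<le> - d * ln (x - 1)"
    using pos by (simp add: ln_div)
  hence "exp (ln (Gamma x / Gamma (x + d))) \<le> exp (- d * ln (x - 1))"
    by simp
  thus ?thesis using pos x by (simp add: powr_def)
qed

text \<open>
  The series with numerator parameters \<open>a\<^sub>1, a\<^sub>2, 1\<close> and denominator parameter \<open>b\<^sub>1\<close> has radius of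
  convergence \<open>\<infinity>\<close> if \<open>\<alpha> > 2\<close>, and, unless it terminates, \<open>4\<close> if \<open>\<alpha> = 2\<close> and \<open>0\<close> if \<open>\<alpha> < 2\<close>.
  It terminates for every \<open>\<alpha>\<close> if \<open>a\<^sub>1\<close> or \<open>a\<^sub>2\<close> is a nonpositive integer.
\<close>

lemma summable_hyp_ML_term:
  assumes "\<alpha> > 2" "\<beta> > 0"
  shows "summable (hyp_ML_term \<alpha> \<beta> [a1, a2, 1] [b1] u)"
proof -
  define c where "c = hyp_ML_term \<alpha> \<beta> [a1, a2, 1] [b1] u"
  define g where "g = (\<lambda>r::nat. Gamma (\<alpha> * real r + \<beta>))"
  define q where "q = (\<lambda>r. (a1 + of_nat r) * (a2 + of_nat r) * (1 + of_nat r) / (b1 + of_nat r)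
                         * (u * complex_of_real (g r / g (Suc r))))"
  have g_pos: "g r > 0" for r
    using assms by (auto simp: g_def intro!: Gamma_real_pos add_nonneg_pos)
  have step: "c (Suc r) = c r * q r" for r
  proof -
    have "complex_of_real (g r) \<noteq> 0" "complex_of_real (g (Suc r)) \<noteq> 0"
      using g_pos[of r] g_pos[of "Suc r"] by auto
    thus ?thesis
      unfolding c_def hyp_ML_term_def q_def g_def[symmetric]
      by (simp add: hyp_ML_term_def pochhammer_Suc g_def divide_simps)
  qed
  define K where "K = (\<lambda>r::nat. (norm a1 + real r) * (norm a2 + real r) * (1 + real r)
        / (real r - norm b1) * (norm u * (\<alpha> * real r + \<beta> - 1) powr (- \<alpha>)))"
  have lim: "K \<longlonglongrightarrow> 0"
    unfolding K_def using assms by real_asymp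
  have "eventually (\<lambda>r. K r < 1/2) sequentially"
    using lim by (rule order_tendstoD) simp
  moreover have "eventually (\<lambda>r. real r > norm b1) sequentially"
    by real_asymp
  moreover have "eventually (\<lambda>r. \<alpha> * real r + \<beta> > 1) sequentially"
    using assms by real_asymp
  ultimately have "eventually (\<lambda>r. norm (q r) \<le> 1/2) sequentially"
  proof eventually_elim
    case (elim r)
    have "g r / g (Suc r) \<le> (\<alpha> * real r + \<beta> - 1) powr (- \<alpha>)"
      using Gamma_shift_bound[of "\<alpha> * real r + \<beta>" \<alpha>] elim assms
      by (simp add: g_def algebra_simps)
    moreover have "norm (b1 + of_nat r) \<ge> real r - norm b1"
      using norm_diff_ineq[of "of_nat r" b1] by (simp add: add.commute)
    moreover have "norm (a1 + of_nat r) \<le> norm a1 + real r" "norm (a2 + of_nat r) \<le> norm a2 + real r"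
      "norm (1 + of_nat r :: complex) \<le> 1 + real r"
      using norm_triangle_ineq[of _ "of_nat r :: complex"] by (auto simp: norm_of_nat)
         (metis norm_of_nat norm_one norm_triangle_ineq)
    ultimately have "norm (q r) \<le> K r"
      unfolding q_def K_def norm_mult norm_divide norm_of_real
      using elim g_pos[of r] g_pos[of "Suc r"]
      by (intro mult_mono frac_le) (auto intro!: mult_nonneg_nonneg)
    with elim show ?case by simp
  qed
  then obtain N where N: "\<And>r. r \<ge> N \<Longrightarrow> norm (q r) \<le> 1/2"
    by (auto simp: eventually_sequentially)
  have "summable c"
  proof (rule summable_ratio_test[of "1/2" N])
    fix r assume "r \<ge> N"
    thus "norm (c (Suc r)) \<le> 1/2 * norm (c r)"
      using mult_left_mono[OF N, of r "norm (c r)"] by (simp add: step norm_mult)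
  qed simp
  thus ?thesis by (simp add: c_def)
qed

end

theory Submission
  imports Defs
begin

text \<open>
  Since \<open>(1)\<^sub>r = r!\<close>, the claim is that Borel's integral method sums a convergent series
  \<open>\<Sum>c\<^sub>r\<close> to its ordinary sum:
  \<open>\<integral>\<^sub>0\<^sup>\<infinity> e\<^sup>-\<^sup>t (\<Sum>c\<^sub>r t\<^sup>r / r!) dt = \<Sum>c\<^sub>r\<close>. Absolute convergence is not available (it can fail on the
  circle of convergence when \<open>\<alpha> = 2\<close>), so sum and integral are not interchanged. Instead, with
  the partial sums \<open>s\<^sub>n = c\<^sub>0 + \<dots> + c\<^sub>n\<^sub>-\<^sub>1\<close>, the function \<open>e\<^sup>-\<^sup>x \<Sum>s\<^sub>n x\<^sup>n / n!\<close> is an antiderivative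
  of the integrand that vanishes at \<open>0\<close>, and it tends to \<open>lim s\<^sub>n\<close> because it is an average of
  the \<open>s\<^sub>n\<close> with Poisson weights.
\<close>

text \<open>Comparison with a multiple of the exponential series: bounded coefficients over
  \<open>fact n\<close> define an entire function.\<close>

lemma norm_summable_bounded_exp_series:
  fixes c :: "nat \<Rightarrow> complex"
  assumes "Bseq c"
  shows "summable (\<lambda>n. norm (c n / fact n * z ^ n))"
proof -
  obtain M where M: "\<And>n. norm (c n) \<le> M"
    using assms by (auto simp: Bseq_def)
  show ?thesis
  proof (rule summable_comparison_test')
    show "summable (\<lambda>n. M * (norm z ^ n / fact n))"
      using summable_exp[of "norm z"] by (intro summable_mult) (simp add: field_simps)
    show "norm (norm (c n / fact n * z ^ n)) \<le> M * (norm z ^ n / fact n)" for n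
      using mult_right_mono[OF M[of n], of "norm z ^ n / fact n"]
      by (simp add: norm_mult norm_divide norm_power)
  qed
qed

lemmas summable_bounded_exp_series =
  summable_norm_cancel[OF norm_summable_bounded_exp_series]

lemma exp_series_complex_sums:
  "(\<lambda>n. 1 / fact n * z ^ n) sums exp (z :: complex)"
  using exp_converges[of z] by (simp add: scaleR_conv_of_real field_simps)

text \<open>A Toeplitz argument: for x \<ge> 0 the weights exp(-x) x^n / n! are nonnegative with sum
  1, and each single weight tends to 0. So the first \<open>N\<close> terms die out, while the tail
  stays below e/2.\<close>

lemma poisson_average_tendsto_0:
  fixes d :: "nat \<Rightarrow> complex"
  assumes "d \<longlonglongrightarrow> 0"
  shows "((\<lambda>x. exp (- complex_of_real x) * (\<Sum>n. d n / fact n * complex_of_real x ^ n))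
            \<longlongrightarrow> 0) at_top"
proof (rule tendstoI)
  fix e :: real assume e: "e > 0"
  have bdd: "Bseq d"
    using assms by (intro convergent_imp_Bseq convergentI)
  obtain N where N: "\<And>n. n \<ge> N \<Longrightarrow> norm (d n) < e / 2"
    using LIMSEQ_D[OF assms, of "e / 2"] e by auto
  define h where "h = (\<lambda>x::real. \<Sum>n<N. norm (d n) / fact n * (x ^ n / exp x))"
  have "(h \<longlongrightarrow> (\<Sum>n<N. norm (d n) / fact n * 0)) at_top"
    unfolding h_def by (intro tendsto_intros tendsto_power_div_exp_0)
  hence "eventually (\<lambda>x. h x < e / 2) at_top"
    using e by (intro order_tendstoD(2)[of h 0]) auto
  thus "eventually (\<lambda>x. dist (exp (- complex_of_real x) *
          (\<Sum>n. d n / fact n * complex_of_real x ^ n)) 0 < e) at_top"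
    using eventually_ge_at_top[of 0]
  proof eventually_elim
    case (elim x)
    define w where "w = (\<lambda>n. norm (d n / fact n * complex_of_real x ^ n))"
    have w: "w n = norm (d n) * (x ^ n / fact n)" for n
      using elim by (simp add: w_def norm_mult norm_divide norm_power)
    have sm: "summable w"
      unfolding w_def by (rule norm_summable_bounded_exp_series[OF bdd])
    have ex: "(\<lambda>n. x ^ n / fact n) sums exp x"
      using exp_converges[of x] by (simp add: field_simps)
    have "w (n + N) \<le> e / 2 * (x ^ (n + N) / fact (n + N))" for n
      unfolding w using N[of "n + N"] elim by (intro mult_right_mono) auto
    hence "(\<Sum>n. w (n + N)) \<le> (\<Sum>n. e / 2 * (x ^ (n + N) / fact (n + N)))"
      using sm sums_summable[OF ex]
      by (intro suminf_le summable_mult) (simp_all only: summable_iff_shift[of w]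
            summable_iff_shift[of "\<lambda>n. x ^ n / fact n"])
    also have "\<dots> = e / 2 * (\<Sum>n. x ^ (n + N) / fact (n + N))"
      using sums_summable[OF ex]
      by (intro suminf_mult) (simp only: summable_iff_shift[of "\<lambda>n. x ^ n / fact n"])
    also have "(\<Sum>n. x ^ (n + N) / fact (n + N)) = exp x - (\<Sum>n<N. x ^ n / fact n)"
      using suminf_minus_initial_segment[OF sums_summable[OF ex], of N] sums_unique[OF ex]
      by simp
    \<comment> \<open>The missing initial segment is nonnegative because x \<ge> 0.\<close>
    also have "e / 2 * \<dots> \<le> e / 2 * exp x"
      using e elim by (intro mult_left_mono) (auto intro!: sum_nonneg)
    finally have tail: "(\<Sum>n. w (n + N)) \<le> e / 2 * exp x" .
    have "(\<Sum>n<N. w n) = h x * exp x"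
      unfolding h_def sum_distrib_right by (intro sum.cong) (auto simp: w)
    hence "suminf w \<le> (h x + e / 2) * exp x"
      using tail suminf_split_initial_segment[OF sm, of N] by (simp add: algebra_simps)
    also have "\<dots> < e * exp x"
      using elim by (intro mult_strict_right_mono) auto
    finally have less: "suminf w < e * exp x" .
    have "norm (\<Sum>n. d n / fact n * complex_of_real x ^ n) \<le> suminf w"
      using sm unfolding w_def by (rule summable_norm)
    hence "norm (\<Sum>n. d n / fact n * complex_of_real x ^ n) < e * exp x"
      using less by simp
    thus ?case
      by (simp add: norm_mult exp_minus field_simps norm_divide norm_inverse)
  qed
qed

text \<open>The weights sum to 1, so subtracting \<open>l\<close> from each \<open>s n\<close>
  subtracts exactly \<open>l\<close> from the average. This reduces to a null sequence.\<close>

lemma poisson_average_tendsto: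
  fixes s :: "nat \<Rightarrow> complex"
  assumes "s \<longlonglongrightarrow> l"
  shows "((\<lambda>x. exp (- complex_of_real x) * (\<Sum>n. s n / fact n * complex_of_real x ^ n))
            \<longlongrightarrow> l) at_top"
proof -
  have bdd: "Bseq s"
    using assms by (intro convergent_imp_Bseq convergentI)
  have eq: "exp (- z) * (\<Sum>n. (s n - l) / fact n * z ^ n) + l
              = exp (- z) * (\<Sum>n. s n / fact n * z ^ n)" for z
  proof -
    have "(\<lambda>n. s n / fact n * z ^ n - l * (1 / fact n * z ^ n))
            sums ((\<Sum>n. s n / fact n * z ^ n) - l * exp z)"
      by (intro sums_diff sums_mult exp_series_complex_sums
            summable_sums[OF summable_bounded_exp_series[OF bdd]])
    hence "(\<Sum>n. (s n - l) / fact n * z ^ n) = (\<Sum>n. s n / fact n * z ^ n) - l * exp z"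
      by (simp add: sums_iff diff_divide_distrib left_diff_distrib)
    thus ?thesis
      by (simp add: exp_minus field_simps)
  qed
  have "(\<lambda>n. s n - l) \<longlonglongrightarrow> 0"
    using assms by (simp add: LIM_zero_iff)
  from tendsto_add[OF poisson_average_tendsto_0[OF this] tendsto_const[of l]]
  show ?thesis by (simp only: eq add_0_left)
qed

text \<open>The fundamental theorem on each [a, y], followed by y to infinity. The Henstock-Kurzweil
  integral over a half-line is a limit over growing boxes, so conditionally convergent integrals are
  covered.\<close>

lemma has_integral_atLeast_of_antiderivative:
  fixes f F :: "real \<Rightarrow> 'a :: banach"
  assumes deriv: "\<And>x. x \<ge> a \<Longrightarrow> (F has_vector_derivative f x) (at x within {a..})"
    and lim: "(F \<longlongrightarrow> l) at_top"
  shows "(f has_integral (l - F a)) {a..}"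
  unfolding has_integral_alt'[of f]
proof (intro conjI allI impI)
  have FTC: "(f has_integral (F y - F a)) {a..y}" if "a \<le> y" for y
    using that
    by (intro fundamental_theorem_of_calculus
          has_vector_derivative_within_subset[OF deriv]) auto
  have eq: "((\<lambda>x. if x \<in> {a..} then f x else 0) has_integral (F y - F a)) {x..y}"
    if "x \<le> a" "a \<le> y" for x y
  proof -
    have "{a..} \<inter> {x..y} = {a..y}" using that by auto
    thus ?thesis
      using FTC[OF that(2)] by (simp only: has_integral_restrict_Int)
  qed
  {
    fix x y :: real
    \<comment> \<open>The box is enlarged to contain \<open>a\<close>, so that \<open>eq\<close>
      applies.\<close>
    have "(\<lambda>x. if x \<in> {a..} then f x else 0) integrable_on cbox (min x a) (max y a)"
      using eq[of "min x a" "max y a"] by (auto simp: integrable_on_def)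
    thus "(\<lambda>x. if x \<in> {a..} then f x else 0) integrable_on cbox x y"
      by (rule integrable_on_subcbox) auto
  }
  fix e :: real assume "e > 0"
  then obtain B where B: "\<And>y. y \<ge> B \<Longrightarrow> norm (F y - l) < e"
    using tendstoD[OF lim] by (auto simp: eventually_at_top_linorder dist_norm)
  show "\<exists>B>0. \<forall>x y. ball 0 B \<subseteq> cbox x y \<longrightarrow>
          norm (integral (cbox x y) (\<lambda>x. if x \<in> {a..} then f x else 0) - (l - F a)) < e"
  \<comment> \<open>A box containing this ball reaches past \<open>a\<close> on both sides and past
    \<open>B\<close> on the right; the 1 keeps the radius positive.\<close>
  proof (intro exI[of _ "max 1 (max \<bar>a\<bar> \<bar>B\<bar>)"] conjI allI impI)
    fix x y :: real
    assume "ball 0 (max 1 (max \<bar>a\<bar> \<bar>B\<bar>)) \<subseteq> cbox x y"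
    \<comment> \<open>Passing to the closed ball makes its two endpoints available.\<close>
    hence "closure (ball 0 (max 1 (max \<bar>a\<bar> \<bar>B\<bar>))) \<subseteq> {x..y}"
      by (intro closure_minimal) auto
    hence "cball 0 (max 1 (max \<bar>a\<bar> \<bar>B\<bar>)) \<subseteq> {x..y}"
      by simp
    hence "x \<le> - max 1 (max \<bar>a\<bar> \<bar>B\<bar>)" "max 1 (max \<bar>a\<bar> \<bar>B\<bar>) \<le> y"
      by (auto simp: cball_eq_atLeastAtMost)
    hence *: "x \<le> a" "a \<le> y" "B \<le> y" by linarith+
    show "norm (integral (cbox x y) (\<lambda>x. if x \<in> {a..} then f x else 0) - (l - F a)) < e"
      using integral_unique[OF eq[OF *(1,2)]] B[OF *(3)] by simp
  qed simp
qed

theorem borel_integral_of_convergent_series: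
  fixes c :: "nat \<Rightarrow> complex"
  assumes "summable c"
  shows "((\<lambda>t. exp (- complex_of_real t) * (\<Sum>n. c n / fact n * complex_of_real t ^ n))
            has_integral suminf c) {0..}"
proof -
  \<comment> \<open>\<open>s n\<close> stops before \<open>c n\<close>: thus \<open>s 0 = 0\<close>,
    which makes the antiderivative vanish at 0, and \<open>s (Suc n) - s n = c n\<close>.\<close>
  define s where "s = (\<lambda>n. \<Sum>k<n. c k)"
  have s_lim: "s \<longlonglongrightarrow> suminf c"
    unfolding s_def by (rule summable_LIMSEQ[OF assms])
  have s_bdd: "Bseq s" and s_Suc_bdd: "Bseq (\<lambda>n. s (Suc n))"
    using s_lim LIMSEQ_Suc[OF s_lim] by (auto intro!: convergent_imp_Bseq convergentI)
  define P where "P = (\<lambda>z. \<Sum>n. s n / fact n * z ^ n)"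
  define Q where "Q = (\<lambda>z. \<Sum>n. s (Suc n) / fact n * z ^ n)"
  \<comment> \<open>Termwise differentiation of an exponential generating function only shifts its
    coefficients, so \<open>Q\<close> is the derivative of \<open>P\<close>.\<close>
  have diffs: "diffs (\<lambda>n. s n / fact n) = (\<lambda>n. s (Suc n) / fact n)"
    by (auto simp: diffs_def fun_eq_iff divide_simps simp del: of_nat_Suc)
  have P_deriv: "(P has_field_derivative Q z) (at z)" for z
    unfolding P_def Q_def
    using termdiffs_strong_converges_everywhere[OF summable_bounded_exp_series[OF s_bdd], of z]
    by (simp only: diffs)
  have QP: "Q z - P z = (\<Sum>n. c n / fact n * z ^ n)" for z
    unfolding Q_def P_def
    by (subst suminf_diff[OF summable_bounded_exp_series[OF s_Suc_bdd]
          summable_bounded_exp_series[OF s_bdd]])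
       (simp add: s_def add_divide_distrib ring_distribs)
  \<comment> \<open>By the product rule the derivative is exp(-z) (Q z - P z).\<close>
  have deriv: "((\<lambda>z. exp (- z) * P z) has_field_derivative
                 exp (- z) * (\<Sum>n. c n / fact n * z ^ n)) (at z)" for z
    unfolding QP[symmetric]
    by (auto intro!: derivative_eq_intros P_deriv simp: algebra_simps)
  have "((\<lambda>t. exp (- complex_of_real t) * (\<Sum>n. c n / fact n * complex_of_real t ^ n))
          has_integral (suminf c - exp (- complex_of_real 0) * P (complex_of_real 0))) {0..}"
    by (intro has_integral_atLeast_of_antiderivative
          [where F = "\<lambda>x. exp (- complex_of_real x) * P (complex_of_real x)"]
          has_vector_derivative_real_field[OF deriv])
       (simp only: P_def poisson_average_tendsto[OF s_lim])
  moreover have "P 0 = 0"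
    using powser_zero[of "\<lambda>n. s n / fact n"] by (simp add: P_def s_def)
  ultimately show ?thesis by simp
qed

text \<open>The extra numerator parameter contributes \<open>pochhammer 1 r = fact r\<close>, which
  the division cancels.\<close>

lemma hyp_ML_term_scale:
  "hyp_ML_term \<alpha> \<beta> as bs (u * z) r = hyp_ML_term \<alpha> \<beta> (as @ [1]) bs u r / fact r * z ^ r"
  by (simp add: hyp_ML_term_def pochhammer_fact[symmetric] power_mult_distrib)

text \<open>Sums and integrals that do not exist have default values, so convergence on the left and
  integrability belong to the conclusion. Summability on the right is assumed since, unless it
  terminates, that series has radius of convergence 0 for \<alpha> < 2.\<close>

theorem mainTheorem13:
  fixes \<alpha> \<beta> :: real and a1 a2 b1 u :: complex
  assumes "\<alpha> > 0" and "\<beta> > 0"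
    and "b1 \<notin> \<int>\<^sub>\<le>\<^sub>0"
    and "summable (hyp_ML_term \<alpha> \<beta> [a1, a2, 1] [b1] (- u))"
  shows "(\<forall>t\<ge>0. summable (hyp_ML_term \<alpha> \<beta> [a1, a2] [b1] (- (u * complex_of_real t))))
    \<and> sumudu_integrand (\<lambda>t. hyp_ML \<alpha> \<beta> [a1, a2] [b1] (- t)) u integrable_on {0..}
    \<and> sumudu (\<lambda>t. hyp_ML \<alpha> \<beta> [a1, a2] [b1] (- t)) u
          = hyp_ML \<alpha> \<beta> [a1, a2, 1] [b1] (- u)"
proof -
  define c where "c = hyp_ML_term \<alpha> \<beta> [a1, a2, 1] [b1] (- u)"
  have c: "summable c"
    using assms(4) by (simp add: c_def)
  \<comment> \<open>Terms of a convergent series are bounded, hence the series on the left converges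
    for every t.\<close>
  have "Bseq c"
    using summable_LIMSEQ_zero[OF c] by (intro convergent_imp_Bseq convergentI)
  have terms: "hyp_ML_term \<alpha> \<beta> [a1, a2] [b1] (- (u * z)) = (\<lambda>r. c r / fact r * z ^ r)" for z
    using hyp_ML_term_scale[of \<alpha> \<beta> "[a1, a2]" "[b1]" "- u" z] by (simp add: c_def fun_eq_iff)
  have "(sumudu_integrand (\<lambda>t. hyp_ML \<alpha> \<beta> [a1, a2] [b1] (- t)) u has_integral suminf c) {0..}"
    using borel_integral_of_convergent_series[OF c]
    by (simp add: sumudu_integrand_def[abs_def] hyp_ML_def terms exp_of_real[symmetric])
  thus ?thesis
    using summable_bounded_exp_series[OF \<open>Bseq c\<close>]
    by (auto simp: terms sumudu_def hyp_ML_def c_def integrable_on_def)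
qed

end
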